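(* Let $n\ge 1$ and suppose that $P$ is a $4n$-gon in the plane whose sides are alternately parallel to the $x$ and $y$ axes. Then, generically, the $(2n-2)$nd iterate of the pentagram map is defined on $P$ and transforms $P$ into a polygon whose odd vertices are all collinear and whose even vertices are all collinear.
   Context: An $N$-gon is a cyclic sequence of points $P_1,\dots,P_N$ (indices mod $N$) in the projective plane containing the affine plane; it need not be convex or embedded, and its sides are the lines $P_iP_{i+1}$. The pentagram map sends $P$ to the $N$-gon $P'$ whose vertices are the intersection points of successive shortest diagonals, $P_i'=(P_{i}P_{i+2})\cap(P_{i+1}P_{i+3})$ (up to a cyclic shift of labels). The odd (even) vertices are those with odd (even) index; as $4n$ is even, this partition into two classes is well defined up to swapping. The $4n$-gons with sides alternately parallel to the axes are parametrized by the $2n$ abscissas of the vertical sides and the $2n$ ordinates of the horizontal sides; "generically" means for all parameters in some nonempty Zariski-open subset of this $4n$-dimensional parameter space. *)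

theory Defs
  imports "HOL-Analysis.Analysis"
begin

text \<open>The real projective plane: points and lines are the one- and two-dimensional linear
  subspaces of \<open>\<real>\<^sup>3\<close>, and incidence is inclusion. For distinct points \<open>A\<close>, \<open>B\<close> the line \<open>AB\<close> is
  \<open>span (A \<union> B)\<close>; distinct lines \<open>l\<close>, \<open>m\<close> meet in the point \<open>l \<inter> m\<close>.\<close>

type_synonym proj_subspace = "(real^3) set"

definition proj_point :: "proj_subspace \<Rightarrow> bool" where
  "proj_point A \<longleftrightarrow> subspace A \<and> dim A = 1"

definition proj_line :: "proj_subspace \<Rightarrow> bool" where
  "proj_line l \<longleftrightarrow> subspace l \<and> dim l = 2"

definition proj_join :: "proj_subspace \<Rightarrow> proj_subspace \<Rightarrow> proj_subspace" where
  "proj_join A B = span (A \<union> B)"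

definition proj_collinear :: "proj_subspace set \<Rightarrow> bool" where
  "proj_collinear S \<longleftrightarrow> (\<exists>l. proj_line l \<and> (\<forall>A\<in>S. A \<subseteq> l))"

text \<open>The point with homogeneous coordinates \<open>(x : y : 1)\<close>.\<close>

definition proj_of_affine :: "real \<times> real \<Rightarrow> proj_subspace" where
  "proj_of_affine a = span {vector [fst a, snd a, 1]}"

text \<open>An \<open>N\<close>-gon is an \<open>N\<close>-periodic family of points indexed by the integers.\<close>

definition cyclic_seq :: "nat \<Rightarrow> (int \<Rightarrow> 'a) \<Rightarrow> bool" where
  "cyclic_seq N P \<longleftrightarrow> (\<forall>i. P (i + int N) = P i)"

definition proj_polygon :: "nat \<Rightarrow> (int \<Rightarrow> proj_subspace) \<Rightarrow> bool" where
  "proj_polygon N P \<longleftrightarrow> cyclic_seq N P \<and> (\<forall>i. proj_point (P i))"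

definition short_diagonal :: "(int \<Rightarrow> proj_subspace) \<Rightarrow> int \<Rightarrow> proj_subspace" where
  "short_diagonal P i = proj_join (P i) (P (i + 2))"

text \<open>The pentagram map is a partial map. It is defined on \<open>P\<close> iff every shortest diagonal is a
  line (its end points are distinct) and successive shortest diagonals are distinct, so that they
  meet in exactly one point.\<close>

definition pentagram :: "(int \<Rightarrow> proj_subspace) \<Rightarrow> (int \<Rightarrow> proj_subspace) option" where
  "pentagram P =
    (if \<forall>i. P i \<noteq> P (i + 2) \<and> short_diagonal P i \<noteq> short_diagonal P (i + 1)
     then Some (\<lambda>i. short_diagonal P i \<inter> short_diagonal P (i + 1))
     else None)"

primrec pentagram_iterate ::
    "nat \<Rightarrow> (int \<Rightarrow> proj_subspace) \<Rightarrow> (int \<Rightarrow> proj_subspace) option" where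
  "pentagram_iterate 0 P = Some P"
| "pentagram_iterate (Suc k) P = Option.bind (pentagram_iterate k P) pentagram"

text \<open>Zariski topology on the real affine space with coordinates indexed by \<open>I\<close>. The inductive
  definition follows that of \<^const>\<open>real_polynomial_function\<close>, which is not applicable as the number
  of coordinates will depend on a natural number.\<close>

definition affine_space :: "'i set \<Rightarrow> ('i \<Rightarrow> real) set" where
  "affine_space I = I \<rightarrow>\<^sub>E UNIV"

inductive polynomial_fun :: "'i set \<Rightarrow> (('i \<Rightarrow> real) \<Rightarrow> real) \<Rightarrow> bool" for I :: "'i set" where
  coord: "i \<in> I \<Longrightarrow> polynomial_fun I (\<lambda>v. v i)"
| const: "polynomial_fun I (\<lambda>v. c)"
| add: "polynomial_fun I f \<Longrightarrow> polynomial_fun I g \<Longrightarrow> polynomial_fun I (\<lambda>v. f v + g v)"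
| mult: "polynomial_fun I f \<Longrightarrow> polynomial_fun I g \<Longrightarrow> polynomial_fun I (\<lambda>v. f v * g v)"

definition zariski_closed :: "'i set \<Rightarrow> ('i \<Rightarrow> real) set \<Rightarrow> bool" where
  "zariski_closed I Z \<longleftrightarrow>
    (\<exists>F. (\<forall>f\<in>F. polynomial_fun I f) \<and> Z = {v \<in> affine_space I. \<forall>f\<in>F. f v = 0})"

definition zariski_open :: "'i set \<Rightarrow> ('i \<Rightarrow> real) set \<Rightarrow> bool" where
  "zariski_open I U \<longleftrightarrow> U \<subseteq> affine_space I \<and> zariski_closed I (affine_space I - U)"

text \<open>Side \<open>i\<close> of \<open>p\<close> joins \<open>p i\<close> to \<open>p (i + 1)\<close>. The flag \<open>b\<close> records which sides are vertical: those
  of even index if \<open>b\<close> is true, those of odd index otherwise. A side of length zero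
  counts as parallel to both axes; this way every choice of abscissas and ordinates is realised
  (lemma \<open>bij_betw_side_params\<close>).\<close>

definition sides_alternately_parallel :: "bool \<Rightarrow> (int \<Rightarrow> real \<times> real) \<Rightarrow> bool" where
  "sides_alternately_parallel b p \<longleftrightarrow>
    (\<forall>i. if even i = b then fst (p i) = fst (p (i + 1)) else snd (p i) = snd (p (i + 1)))"

text \<open>The \<open>4n\<close> parameters of such a \<open>4n\<close>-gon: entry \<open>i\<close> is the abscissa of side \<open>i\<close> if this side is
  vertical and its ordinate if it is horizontal.\<close>

definition side_params :: "nat \<Rightarrow> bool \<Rightarrow> (int \<Rightarrow> real \<times> real) \<Rightarrow> nat \<Rightarrow> real" where
  "side_params n b p =
    (\<lambda>i\<in>{..<4 * n}. if even i = b then fst (p (int i)) else snd (p (int i)))"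

lemma cyclic_seq_mod:
  assumes "cyclic_seq N p"
  shows "p (i mod int N) = p i"
proof -
  have nat: "p (j + int k * int N) = p j" for j k
  proof (induction k)
    case (Suc k)
    have "p (j + int (Suc k) * int N) = p ((j + int k * int N) + int N)"
      by (simp add: algebra_simps)
    with Suc assms show ?case by (simp add: cyclic_seq_def)
  qed simp
  have "p (j + k * int N) = p j" for j k
  proof (cases "k \<ge> 0")
    case True
    then show ?thesis using nat[of j "nat k"] by simp
  next
    case False
    then show ?thesis using nat[of "j + k * int N" "nat (- k)"] by simp
  qed
  from this[of "i mod int N" "i div int N"] show ?thesis
    by (simp add: mult.commute)
qed

lemma bij_betw_side_params:
  assumes "n \<ge> 1"
  shows "bij_betw (side_params n b)
    {p. cyclic_seq (4 * n) p \<and> sides_alternately_parallel b p} (affine_space {..<4 * n})"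
proof -
  define side where "side = (\<lambda>v (j::int). v (nat (j mod int (4 * n))) :: real)"
  define gon where "gon = (\<lambda>v (i::int). if even i = b then (side v i, side v (i - 1))
    else (side v (i - 1), side v i))"
  have par: "even (i mod int (4 * n)) = even i" for i
  proof -
    have "even (int (4 * n))" by simp
    then show ?thesis by (metis dvd_mod_iff)
  qed
  have side_p: "side (side_params n b p) i = (if even i = b then fst (p i) else snd (p i))"
    if "cyclic_seq (4 * n) p" for p i
  proof -
    have lt: "nat (i mod int (4 * n)) < 4 * n" and ge: "0 \<le> i mod int (4 * n)"
      using assms by (auto simp: nat_less_iff)
    have ev: "even (nat (i mod int (4 * n))) = even i"
      using par[of i] ge by (metis even_of_nat int_nat_eq)
    show ?thesis
      using lt ge ev cyclic_seq_mod[OF that, of i] by (simp add: side_def side_params_def)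
  qed
  show ?thesis
  proof (rule bij_betw_byWitness[where f' = gon])
    show "\<forall>p\<in>{p. cyclic_seq (4 * n) p \<and> sides_alternately_parallel b p}.
        gon (side_params n b p) = p"
    proof safe
      fix p assume p: "cyclic_seq (4 * n) p" "sides_alternately_parallel b p"
      show "gon (side_params n b p) = p"
      proof
        fix i
        have "if even (i - 1) = b then fst (p (i - 1)) = fst (p i) else snd (p (i - 1)) = snd (p i)"
          using p(2)[unfolded sides_alternately_parallel_def, rule_format, of "i - 1"] by simp
        then show "gon (side_params n b p) i = p i"
          by (auto simp: gon_def side_p[OF p(1)] prod_eq_iff split: if_splits)
      qed
    qed
    show "\<forall>v\<in>affine_space {..<4 * n}. side_params n b (gon v) = v"
    proof
      fix v assume v: "v \<in> affine_space {..<4 * n}"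
      show "side_params n b (gon v) = v"
      proof
        fix i
        have "side v (int i) = v i" if "i < 4 * n"
        proof -
          have "int i mod int (4 * n) = int i" using that by (intro mod_pos_pos_trivial) linarith+
          then show ?thesis by (simp only: side_def nat_int)
        qed
        moreover have "v i = undefined" if "\<not> i < 4 * n"
          using that v unfolding affine_space_def by (intro PiE_arb[of v "{..<4 * n}"]) simp_all
        ultimately show "side_params n b (gon v) i = v i"
          by (simp add: side_params_def gon_def)
      qed
    qed
    show "side_params n b ` {p. cyclic_seq (4 * n) p \<and> sides_alternately_parallel b p}
        \<subseteq> affine_space {..<4 * n}"
      by (intro image_subsetI) (simp add: side_params_def affine_space_def restrict_PiE_iff del: restrict_apply)
    show "gon ` affine_space {..<4 * n}
        \<subseteq> {p. cyclic_seq (4 * n) p \<and> sides_alternately_parallel b p}"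
    proof safe
      fix v
      have per: "side v (i + int (4 * n)) = side v i" for i
        unfolding side_def by (simp only: mod_add_self2)
      have "side v (i + int (4 * n) - 1) = side v (i - 1)" for i
        using per[of "i - 1"] by (simp add: algebra_simps)
      then show "cyclic_seq (4 * n) (gon v)"
        using per unfolding cyclic_seq_def gon_def by simp
      show "sides_alternately_parallel b (gon v)"
        unfolding sides_alternately_parallel_def gon_def by auto
    qed
  qed
qed

lemma proj_point_proj_of_affine: "proj_point (proj_of_affine a)"
proof -
  have "(vector [fst a, snd a, 1] :: real^3) \<noteq> 0"
    by (metis vector_3(3) zero_index zero_neq_one)
  then show ?thesis
    by (simp add: proj_point_def proj_of_affine_def dim_span dim_singleton)
qed

lemma proj_line_proj_join:
  assumes "proj_point A" "proj_point B" "A \<noteq> B"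
  shows "proj_line (proj_join A B)"
proof -
  have s: "subspace A" "subspace B" and d: "dim A = 1" "dim B = 1"
    using assms by (auto simp: proj_point_def)
  have sub: "subspace (A \<inter> B)" using s by (rule subspace_inter)
  have "dim (A \<inter> B) \<noteq> 1"
    using subspace_dim_equal[OF sub s(1)] subspace_dim_equal[OF sub s(2)] assms(3) d by force
  moreover have "dim (A \<inter> B) \<le> 1" using dim_subset[of "A \<inter> B" A] d by simp
  ultimately have "dim (A \<inter> B) = 0" by linarith
  then have "dim {x + y |x y. x \<in> A \<and> y \<in> B} = 2"
    using dim_sums_Int[OF s] d by linarith
  moreover have "span (A \<union> B) = {x + y |x y. x \<in> A \<and> y \<in> B}"
    using s by (auto simp: span_Un span_eq_iff[THEN iffD2])
  ultimately show ?thesis by (metis proj_line_def proj_join_def subspace_span)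
qed

lemma proj_point_Int:
  assumes "proj_line l" "proj_line m" "l \<noteq> m"
  shows "proj_point (l \<inter> m)"
proof -
  have s: "subspace l" "subspace m" and d: "dim l = 2" "dim m = 2"
    using assms by (auto simp: proj_line_def)
  have sub: "subspace (l \<inter> m)" using s by (rule subspace_inter)
  have "dim (l \<inter> m) \<noteq> 2"
    using subspace_dim_equal[OF sub s(1)] subspace_dim_equal[OF sub s(2)] assms(3) d by force
  moreover have "dim (l \<inter> m) \<le> 2" using dim_subset[of "l \<inter> m" l] d by simp
  moreover have "dim {x + y |x y. x \<in> l \<and> y \<in> m} \<le> 3"
    using dim_subset_UNIV[of "{x + y |x y. x \<in> l \<and> y \<in> m}"] by simp
  ultimately have "dim (l \<inter> m) = 1" using dim_sums_Int[OF s] d by simp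
  with sub show ?thesis by (simp add: proj_point_def)
qed

lemma proj_polygon_pentagram:
  assumes "proj_polygon N P" "pentagram P = Some Q"
  shows "proj_polygon N Q"
proof -
  have P: "\<And>i. P (i + int N) = P i" "\<And>i. proj_point (P i)"
    using assms(1) by (auto simp: proj_polygon_def cyclic_seq_def)
  have ne: "P i \<noteq> P (i + 2)" "short_diagonal P i \<noteq> short_diagonal P (i + 1)" for i
    using assms(2) by (auto simp: pentagram_def split: if_splits)
  have Q: "Q = (\<lambda>i. short_diagonal P i \<inter> short_diagonal P (i + 1))"
    using assms(2) by (auto simp: pentagram_def split: if_splits)
  have line: "proj_line (short_diagonal P i)" for i
    unfolding short_diagonal_def by (rule proj_line_proj_join) (use P ne in auto)
  have per: "short_diagonal P (i + int N) = short_diagonal P i" for i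
    using P(1)[of i] P(1)[of "i + 2"] by (simp add: short_diagonal_def algebra_simps)
  have "Q (i + int N) = Q i" for i
    using per[of i] per[of "i + 1"] by (simp add: Q algebra_simps)
  moreover have "proj_point (Q i)" for i
    unfolding Q by (rule proj_point_Int) (use line ne in auto)
  ultimately show ?thesis by (simp add: proj_polygon_def cyclic_seq_def)
qed

end

theory Submission
  imports Defs "Jordan_Normal_Form.Determinant"
begin

text \<open>Let \<open>c l\<close> be the coordinate fixed by side \<open>l\<close>. Attach weights \<open>w 0, \<dots>, w (r - 1)\<close> of sum 1 to
  the vertices \<open>i, i + 2, \<dots>, i + 2r - 2\<close>; their combination has the coordinates \<open>\<gamma> (i - 1)\<close>
  and \<open>\<gamma> i\<close>, where \<open>\<gamma> l = (\<Sum>j. w j * c (l + 2j))\<close>. By induction on \<open>k\<close>, the shortest diagonal \<open>i\<close>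
  of the \<open>k\<close>-th iterate consists of the combinations with \<open>k + 2\<close> weights for which
  \<open>\<gamma> (i - 1), \<dots>, \<gamma> (i + k)\<close> is 2-periodic, and its vertex \<open>i\<close> is the combination with \<open>k + 1\<close>
  weights satisfying the same condition. Indeed this diagonal contains the vertices \<open>i\<close> and
  \<open>i + 2\<close> (their weights vanish at the right and left end), and the intersection of two successive
  diagonals lengthens the window by one. For \<open>k = 2n - 2\<close> the \<open>k + 2 = 2n\<close> weights run through a
  whole class of vertices, so a cyclic shift of the weights identifies diagonals \<open>i\<close> and
  \<open>i + 2\<close>. Genericity amounts to the nonvanishing of finitely many determinants in the \<open>c l\<close>, each of
  which is nonzero for a suitable \<open>c\<close> with only one nonzero entry in each parity class.\<close>

section \<open>Generic points of affine space\<close>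

lemma polynomial_fun_sum:
  "(\<And>x. x \<in> A \<Longrightarrow> polynomial_fun I (f x)) \<Longrightarrow> polynomial_fun I (\<lambda>v. \<Sum>x\<in>A. f x v)"
  by (induction A rule: infinite_finite_induct) (auto intro: polynomial_fun.intros)

lemma polynomial_fun_prod:
  "(\<And>x. x \<in> A \<Longrightarrow> polynomial_fun I (f x)) \<Longrightarrow> polynomial_fun I (\<lambda>v. \<Prod>x\<in>A. f x v)"
  by (induction A rule: infinite_finite_induct) (auto intro: polynomial_fun.intros)

lemma polynomial_fun_diff:
  assumes "polynomial_fun I f" "polynomial_fun I g"
  shows "polynomial_fun I (\<lambda>v. f v - g v)"
  using polynomial_fun.add[OF assms(1) polynomial_fun.mult[OF polynomial_fun.const[of I "-1"] assms(2)]]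
  by simp

lemma polynomial_fun_on_line:
  assumes "polynomial_fun I f"
  shows "\<exists>q. \<forall>t. f (\<lambda>i. u i + t * (v i - u i)) = poly q t"
  using assms
proof induction
  case (coord i)
  show ?case by (intro exI[of _ "[:u i, v i - u i:]"]) simp
next
  case (const c)
  show ?case by (intro exI[of _ "[:c:]"]) simp
next
  case (add f g)
  then show ?case by (metis poly_add)
next
  case (mult f g)
  then show ?case by (metis poly_mult)
qed

text \<open>On the line through \<open>u\<close> and \<open>v\<close> both functions become nonzero
  polynomials in one variable, so only finitely many parameters \<open>t\<close> are excluded. This
  is the irreducibility of affine space.\<close>

lemma polynomial_fun_mult_nonzero:
  assumes "polynomial_fun I f" "polynomial_fun I g"
    and "u \<in> affine_space I" "f u \<noteq> 0" "v \<in> affine_space I" "g v \<noteq> 0"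
  shows "\<exists>z\<in>affine_space I. f z * g z \<noteq> 0"
proof -
  define line where "line t = (\<lambda>i. u i + t * (v i - u i))" for t :: real
  obtain q r where q: "\<And>t. f (line t) = poly q t" and r: "\<And>t. g (line t) = poly r t"
    using polynomial_fun_on_line[OF assms(1)] polynomial_fun_on_line[OF assms(2)]
    unfolding line_def by metis
  have "line 0 = u" "line 1 = v" by (auto simp: line_def)
  then have "q \<noteq> 0" "r \<noteq> 0" using q[of 0] r[of 1] assms by auto
  then have "finite {t. poly (q * r) t = 0}" by (intro poly_roots_finite) simp
  then obtain t where "poly (q * r) t \<noteq> 0"
    using infinite_UNIV_char_0[where 'a = real] by (metis (mono_tags) UNIV_eq_I mem_Collect_eq)
  \<comment> \<open>Outside \<open>I\<close> both \<open>u\<close> and \<open>v\<close> take the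
    value \<open>undefined\<close>, and so does every point of the line.\<close>
  moreover have "line t \<in> affine_space I"
    using assms(3,5) by (auto simp: affine_space_def PiE_iff extensional_def line_def)
  ultimately show ?thesis using q r by (intro bexI[of _ "line t"]) auto
qed

text \<open>A single polynomial serves as witness, so that finite conjunctions amount to products of
  witnesses.\<close>

definition zariski_generic :: "'i set \<Rightarrow> (('i \<Rightarrow> real) \<Rightarrow> bool) \<Rightarrow> bool" where
  "zariski_generic I R \<longleftrightarrow>
    (\<exists>g. polynomial_fun I g \<and> (\<exists>v\<in>affine_space I. g v \<noteq> 0) \<and> (\<forall>v. g v \<noteq> 0 \<longrightarrow> R v))"

lemma zariski_generic_True: "zariski_generic I (\<lambda>v. True)"
proof -
  have "(\<lambda>i\<in>I. 0) \<in> affine_space I" by (simp add: affine_space_def)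
  then show ?thesis unfolding zariski_generic_def
    by (intro exI[of _ "\<lambda>v. 1"]) (auto intro: polynomial_fun.const)
qed

lemma zariski_generic_conj:
  assumes "zariski_generic I R" "zariski_generic I S"
  shows "zariski_generic I (\<lambda>v. R v \<and> S v)"
proof -
  obtain f u where f: "polynomial_fun I f" "u \<in> affine_space I" "f u \<noteq> 0" "\<And>v. f v \<noteq> 0 \<Longrightarrow> R v"
    using assms(1) unfolding zariski_generic_def by auto
  obtain g v where g: "polynomial_fun I g" "v \<in> affine_space I" "g v \<noteq> 0" "\<And>v. g v \<noteq> 0 \<Longrightarrow> S v"
    using assms(2) unfolding zariski_generic_def by auto
  have "\<exists>z\<in>affine_space I. f z * g z \<noteq> 0"
    using polynomial_fun_mult_nonzero f(1-3) g(1-3) by blast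
  then show ?thesis unfolding zariski_generic_def
    using f g by (intro exI[of _ "\<lambda>z. f z * g z"]) (auto intro: polynomial_fun.mult)
qed

lemma zariski_generic_ball:
  assumes "finite T" "\<And>t. t \<in> T \<Longrightarrow> zariski_generic I (R t)"
  shows "zariski_generic I (\<lambda>v. \<forall>t\<in>T. R t v)"
  using assms
proof (induction T rule: finite_induct)
  case empty
  then show ?case using zariski_generic_True by simp
next
  case (insert t T)
  then have "zariski_generic I (\<lambda>v. R t v \<and> (\<forall>t\<in>T. R t v))" by (intro zariski_generic_conj) auto
  then show ?case by simp
qed

lemma zariski_generic_open:
  assumes "zariski_generic I R"
  shows "\<exists>U. zariski_open I U \<and> U \<noteq> {} \<and> (\<forall>v\<in>U. R v)"
proof -
  obtain g u where g: "polynomial_fun I g" "u \<in> affine_space I" "g u \<noteq> 0" "\<And>v. g v \<noteq> 0 \<Longrightarrow> R v"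
    using assms unfolding zariski_generic_def by auto
  define U where "U = {v \<in> affine_space I. g v \<noteq> 0}"
  have "affine_space I - U = {v \<in> affine_space I. \<forall>f\<in>{g}. f v = 0}" by (auto simp: U_def)
  then have "zariski_open I U"
    unfolding zariski_open_def zariski_closed_def
    using g(1) by (intro conjI exI[of _ "{g}"]) (auto simp: U_def)
  then show ?thesis using g by (intro exI[of _ U]) (auto simp: U_def)
qed

text \<open>A square system has trivial kernel iff its determinant is nonzero. By the Leibniz
  formula the determinant is a polynomial in the parameters, and the single point \<open>u\<close>
  shows that it does not vanish identically.\<close>

lemma zariski_generic_trivial_kernel:
  fixes f :: "nat \<Rightarrow> nat \<Rightarrow> ('i \<Rightarrow> real) \<Rightarrow> real"
  assumes f: "\<And>m j. polynomial_fun I (f m j)"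
    and u: "u \<in> affine_space I"
    and ker: "\<And>w. (\<And>m. m < k \<Longrightarrow> (\<Sum>j<k. w j * f m j u) = 0) \<Longrightarrow> \<forall>j<k. w j = 0"
  shows "zariski_generic I
    (\<lambda>v. \<forall>w. (\<forall>m<k. (\<Sum>j<k. w j * f m j v) = 0) \<longrightarrow> (\<forall>j<k. w j = 0))"
proof -
  define M where "M v = Matrix.mat k k (\<lambda>(m, j). f m j v)" for v
  have M: "M v \<in> carrier_mat k k" for v by (simp add: M_def)
  have mult: "vec_index (M v *\<^sub>v Matrix.vec k w) m = (\<Sum>j<k. w j * f m j v)" if "m < k" for v w m
    using that by (simp add: M_def scalar_prod_def lessThan_atLeast0 mult.commute)
  have iff: "Determinant.det (M v) \<noteq> 0 \<longleftrightarrow>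
      (\<forall>w. (\<forall>m<k. (\<Sum>j<k. w j * f m j v) = 0) \<longrightarrow> (\<forall>j<k. w j = 0))" for v
  proof -
    have "Determinant.det (M v) = 0 \<longleftrightarrow>
        (\<exists>x. x \<in> carrier_vec k \<and> x \<noteq> 0\<^sub>v k \<and> M v *\<^sub>v x = 0\<^sub>v k)"
      by (rule det_0_iff_vec_prod_zero[OF M])
    also have "\<dots> \<longleftrightarrow> (\<exists>w. (\<forall>m<k. (\<Sum>j<k. w j * f m j v) = 0) \<and> \<not> (\<forall>j<k. w j = 0))"
    proof
      assume "\<exists>x. x \<in> carrier_vec k \<and> x \<noteq> 0\<^sub>v k \<and> M v *\<^sub>v x = 0\<^sub>v k"
      then obtain x where x: "x \<in> carrier_vec k" "x \<noteq> 0\<^sub>v k" "M v *\<^sub>v x = 0\<^sub>v k" by blast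
      have xv: "x = Matrix.vec k (vec_index x)" using x(1) by auto
      have "(\<Sum>j<k. vec_index x j * f m j v) = 0" if "m < k" for m
        using mult[OF that, of v "vec_index x"] x(3) xv that by simp
      moreover have "\<not> (\<forall>j<k. vec_index x j = 0)" using x(1,2) by auto
      ultimately show "\<exists>w. (\<forall>m<k. (\<Sum>j<k. w j * f m j v) = 0) \<and> \<not> (\<forall>j<k. w j = 0)" by blast
    next
      assume "\<exists>w. (\<forall>m<k. (\<Sum>j<k. w j * f m j v) = 0) \<and> \<not> (\<forall>j<k. w j = 0)"
      then obtain w where w: "\<forall>m<k. (\<Sum>j<k. w j * f m j v) = 0" "\<not> (\<forall>j<k. w j = 0)" by blast
      have "M v *\<^sub>v Matrix.vec k w = 0\<^sub>v k"
        using w(1) mult by (intro eq_vecI) (auto simp: M_def)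
      moreover have "Matrix.vec k w \<noteq> 0\<^sub>v k" using w(2) by (metis index_vec index_zero_vec(1))
      ultimately show "\<exists>x. x \<in> carrier_vec k \<and> x \<noteq> 0\<^sub>v k \<and> M v *\<^sub>v x = 0\<^sub>v k"
        by (intro exI[of _ "Matrix.vec k w"]) auto
    qed
    finally show ?thesis by blast
  qed
  have "Determinant.det (M v) =
      (\<Sum>p\<in>{p. p permutes {0..<k}}. signof p * (\<Prod>i=0..<k. if i < k \<and> p i < k then f i (p i) v else 0))" for v
    unfolding det_def'[OF M]
    by (intro sum.cong prod.cong arg_cong2[of _ _ _ _ "(*)"] refl)
      (auto simp: M_def permutes_in_image)
  moreover have "polynomial_fun I (\<lambda>v. \<Sum>p\<in>{p. p permutes {0..<k}}.
      signof p * (\<Prod>i=0..<k. if i < k \<and> p i < k then f i (p i) v else 0))"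
    by (intro polynomial_fun_sum polynomial_fun.mult polynomial_fun_prod polynomial_fun.const)
      (auto intro: f polynomial_fun.const)
  ultimately have "polynomial_fun I (\<lambda>v. Determinant.det (M v))" by simp
  then show ?thesis unfolding zariski_generic_def
    using u ker by (intro exI[of _ "\<lambda>v. Determinant.det (M v)"]) (auto simp: iff)
qed

section \<open>Barycentric combinations of vertices\<close>

text \<open>This is \<gamma> of the introduction, with the number \<open>r\<close> of weights made
  explicit.\<close>

definition side_sum :: "(int \<Rightarrow> real) \<Rightarrow> nat \<Rightarrow> (nat \<Rightarrow> real) \<Rightarrow> int \<Rightarrow> real" where
  "side_sum c r w l = (\<Sum>j<r. w j * c (l + 2 * int j))"

definition side_coord :: "bool \<Rightarrow> int \<Rightarrow> real^3 \<Rightarrow> real" where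
  "side_coord b l X = vec_nth X (if even l = b then 1 else 2)"

text \<open>A window of \<open>h \<ge> 2\<close> sides sees both affine coordinates of \<open>X\<close>, so that the condition forces
  the side sums to be 2-periodic on it. Weights are not normalised: their sum is the third homogeneous
  coordinate.\<close>

definition bary_weights ::
    "bool \<Rightarrow> (int \<Rightarrow> real) \<Rightarrow> int \<Rightarrow> nat \<Rightarrow> nat \<Rightarrow> (nat \<Rightarrow> real) \<Rightarrow> real^3 \<Rightarrow> bool" where
  "bary_weights b c i r h w X \<longleftrightarrow> (\<Sum>j<r. w j) = vec_nth X 3 \<and>
    (\<forall>l\<in>{i..<i + int h}. side_sum c r w l = side_coord b l X)"

definition bary_space :: "bool \<Rightarrow> (int \<Rightarrow> real) \<Rightarrow> int \<Rightarrow> nat \<Rightarrow> nat \<Rightarrow> proj_subspace" where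
  "bary_space b c i r h = {X. \<exists>w. bary_weights b c i r h w X}"

text \<open>The window starts at \<open>i - 1\<close> because vertex \<open>i\<close> of the
  original polygon lies on the sides \<open>i - 1\<close> and \<open>i\<close>.\<close>

definition iter_point :: "bool \<Rightarrow> (int \<Rightarrow> real) \<Rightarrow> nat \<Rightarrow> int \<Rightarrow> proj_subspace" where
  "iter_point b c k i = bary_space b c (i - 1) (k + 1) (k + 2)"

definition iter_line :: "bool \<Rightarrow> (int \<Rightarrow> real) \<Rightarrow> nat \<Rightarrow> int \<Rightarrow> proj_subspace" where
  "iter_line b c k i = bary_space b c (i - 1) (k + 2) (k + 2)"

text \<open>Excludes nontrivial 2-periodic side sums of \<open>k\<close> weights on a window of
  \<open>k + 2\<close> sides; this bounds the dimension of \<open>iter_point\<close>.\<close>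

definition diff_regular :: "(int \<Rightarrow> real) \<Rightarrow> nat \<Rightarrow> int \<Rightarrow> bool" where
  "diff_regular c k i \<longleftrightarrow>
    (\<forall>w. (\<forall>l\<in>{i..<i + int k}. side_sum c k w (l + 2) = side_sum c k w l) \<longrightarrow> (\<forall>j<k. w j = 0))"

text \<open>Makes \<open>r\<close> weights recoverable from their sum and \<open>r - 1\<close>
  successive side sums, that is, from the vector that they represent.\<close>

definition sum_regular :: "(int \<Rightarrow> real) \<Rightarrow> nat \<Rightarrow> int \<Rightarrow> bool" where
  "sum_regular c r i \<longleftrightarrow>
    (\<forall>w. (\<Sum>j<r. w j) = 0 \<and> (\<forall>l\<in>{i..<i + int r - 1}. side_sum c r w l = 0) \<longrightarrow> (\<forall>j<r. w j = 0))"

section \<open>Linearity of the weight conditions\<close>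

lemma side_sum_linear:
  "side_sum c r (\<lambda>j. w j + a * w' j) l = side_sum c r w l + a * side_sum c r w' l"
  by (simp add: side_sum_def algebra_simps sum.distrib sum_distrib_left)

lemma side_coord_linear:
  "side_coord b l (X + a *\<^sub>R Y) = side_coord b l X + a * side_coord b l Y"
  by (simp add: side_coord_def)

lemma side_coord_add_2 [simp]: "side_coord b (l + 2) X = side_coord b l X"
  by (simp add: side_coord_def)

lemma bary_weights_linear:
  assumes "bary_weights b c i r h w X" "bary_weights b c i r h w' Y"
  shows "bary_weights b c i r h (\<lambda>j. w j + a * w' j) (X + a *\<^sub>R Y)"
  using assms
  by (auto simp: bary_weights_def side_sum_linear side_coord_linear sum.distrib
      sum_distrib_left[symmetric])

lemma bary_weights_0: "bary_weights b c i r h (\<lambda>j. 0) 0"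
  by (simp add: bary_weights_def side_sum_def side_coord_def)

lemma subspace_bary_space: "subspace (bary_space b c i r h)"
proof -
  have "X + Y \<in> bary_space b c i r h" if "X \<in> bary_space b c i r h" "Y \<in> bary_space b c i r h" for X Y
    using that bary_weights_linear[where a = 1] unfolding bary_space_def by fastforce
  moreover have "a *\<^sub>R X \<in> bary_space b c i r h" if "X \<in> bary_space b c i r h" for a X
    using that bary_weights_linear[OF bary_weights_0, where a = a and Y = X]
    unfolding bary_space_def by fastforce
  moreover have "0 \<in> bary_space b c i r h"
    using bary_weights_0 unfolding bary_space_def by blast
  ultimately show ?thesis by (simp add: subspace_def)
qed

section \<open>Zero weights at the ends\<close>

lemma bary_weights_Suc:
  "w r = 0 \<Longrightarrow> bary_weights b c i (Suc r) h w X \<longleftrightarrow> bary_weights b c i r h w X"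
  by (simp add: bary_weights_def side_sum_def)

lemma bary_weights_cong:
  "(\<And>j. j < r \<Longrightarrow> w j = w' j) \<Longrightarrow> bary_weights b c i r h w X \<longleftrightarrow> bary_weights b c i r h w' X"
  by (simp add: bary_weights_def side_sum_def)

lemma side_sum_Suc_shift:
  "side_sum c (Suc r) w l = w 0 * c l + side_sum c r (\<lambda>j. w (Suc j)) (l + 2)"
  unfolding side_sum_def by (subst sum.lessThan_Suc_shift) (simp add: algebra_simps)

lemma ball_shift_2:
  "(\<forall>l\<in>{i..<i + int h}. Q (l + 2)) \<longleftrightarrow> (\<forall>l\<in>{i + 2..<i + 2 + int h}. Q l)"
proof
  assume *: "\<forall>l\<in>{i..<i + int h}. Q (l + 2)"
  show "\<forall>l\<in>{i + 2..<i + 2 + int h}. Q l"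
  proof
    fix l assume "l \<in> {i + 2..<i + 2 + int h}"
    then show "Q l" using *[rule_format, of "l - 2"] by simp
  qed
qed simp

text \<open>Without its first vertex the combination starts one vertex of the class later, that is,
  two sides later. The conditions carry over because \<open>side_coord\<close> sees only the parity
  of the side.\<close>

lemma bary_weights_Suc_shift:
  assumes "w 0 = 0"
  shows "bary_weights b c i (Suc r) h w X \<longleftrightarrow> bary_weights b c (i + 2) r h (\<lambda>j. w (Suc j)) X"
proof -
  have "(\<forall>l\<in>{i..<i + int h}. side_sum c r (\<lambda>j. w (Suc j)) (l + 2) = side_coord b (l + 2) X) \<longleftrightarrow>
      (\<forall>l\<in>{i + 2..<i + 2 + int h}. side_sum c r (\<lambda>j. w (Suc j)) l = side_coord b l X)"
    by (rule ball_shift_2)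
  then show ?thesis
    unfolding bary_weights_def side_sum_Suc_shift sum.lessThan_Suc_shift using assms by simp
qed

lemma bary_weights_zero:
  assumes "\<forall>j<r. w j = 0" "bary_weights b c i r h w X" "h \<ge> 2"
  shows "X = 0"
proof -
  have "side_coord b i X = 0" "side_coord b (i + 1) X = 0" "vec_nth X 3 = 0"
    using assms by (auto simp: bary_weights_def side_sum_def)
  then show ?thesis
    by (auto simp: side_coord_def Finite_Cartesian_Product.vec_eq_iff forall_3 split: if_splits)
qed

text \<open>Comparing the conditions at \<open>l\<close> and \<open>l + 2\<close> eliminates
  \<open>X\<close> and leaves exactly the \<open>k\<close> homogeneous equations of
  \<open>diff_regular\<close>.\<close>

lemma bary_space_trivial:
  assumes "diff_regular c k i"
  shows "bary_space b c i k (k + 2) \<subseteq> {0}"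
proof
  fix X assume "X \<in> bary_space b c i k (k + 2)"
  then obtain w where w: "bary_weights b c i k (k + 2) w X" by (auto simp: bary_space_def)
  have "side_sum c k w (l + 2) = side_sum c k w l" if "l \<in> {i..<i + int k}" for l
  proof -
    have "l \<in> {i..<i + int (k + 2)}" "l + 2 \<in> {i..<i + int (k + 2)}" using that by auto
    then show ?thesis using w side_coord_add_2 unfolding bary_weights_def by metis
  qed
  then have "\<forall>j<k. w j = 0" using assms by (auto simp: diff_regular_def)
  then show "X \<in> {0}" using bary_weights_zero[OF _ w] by simp
qed

text \<open>Provides the pivot for eliminating the last weight of other combinations; were it zero,
  only \<open>k\<close> weights would remain.\<close>

lemma bary_weights_last_nonzero:
  assumes "diff_regular c k i" "bary_weights b c i (Suc k) (k + 2) w X" "X \<noteq> 0"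
  shows "w k \<noteq> 0"
proof
  assume "w k = 0"
  then have "X \<in> bary_space b c i k (k + 2)"
    using assms(2) by (auto simp: bary_weights_Suc bary_space_def)
  then show False using bary_space_trivial[OF assms(1)] assms(3) by blast
qed

text \<open>The difference of the two weight systems represents zero on the common part of the
  windows, where \<open>r - 1\<close> sides suffice. Successive diagonals have windows with just
  this overlap.\<close>

lemma bary_weights_unique:
  assumes "sum_regular c r i" "bary_weights b c i' r h' w X" "bary_weights b c i'' r h'' w' X"
    and "{i..<i + int r - 1} \<subseteq> {i'..<i' + int h'} \<inter> {i''..<i'' + int h''}" "j < r"
  shows "w j = w' j"
proof -
  let ?d = "\<lambda>j. w j + (-1) * w' j"
  have "(\<Sum>j<r. ?d j) = 0"
    using assms(2,3) by (simp add: bary_weights_def sum_subtractf)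
  moreover have "side_sum c r ?d l = 0" if "l \<in> {i..<i + int r - 1}" for l
  proof -
    have "l \<in> {i'..<i' + int h'}" "l \<in> {i''..<i'' + int h''}" using that assms(4) by blast+
    then have "side_sum c r w l = side_coord b l X" "side_sum c r w' l = side_coord b l X"
      using assms(2,3) by (auto simp: bary_weights_def)
    then show ?thesis unfolding side_sum_linear by simp
  qed
  ultimately have "?d j = 0"
    using assms(1,5) unfolding sum_regular_def by blast
  then show ?thesis by simp
qed

section \<open>The iterates of the pentagram map\<close>

lemma iter_point_subset_iter_line: "iter_point b c k i \<subseteq> iter_line b c k i"
proof
  fix X assume "X \<in> iter_point b c k i"
  then obtain w where "bary_weights b c (i - 1) (k + 1) (k + 2) w X"
    by (auto simp: iter_point_def bary_space_def)
  then have "bary_weights b c (i - 1) (k + 1) (k + 2) (w(k + 1 := 0)) X"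
    by (subst bary_weights_cong[where w' = w]) auto
  then have "bary_weights b c (i - 1) (Suc (k + 1)) (k + 2) (w(k + 1 := 0)) X"
    by (subst bary_weights_Suc) auto
  then show "X \<in> iter_line b c k i" by (auto simp: iter_line_def bary_space_def)
qed

lemma iter_point_add_2_subset_iter_line: "iter_point b c k (i + 2) \<subseteq> iter_line b c k i"
proof
  fix X assume "X \<in> iter_point b c k (i + 2)"
  then obtain w where "bary_weights b c (i - 1 + 2) (k + 1) (k + 2) w X"
    by (auto simp: iter_point_def bary_space_def algebra_simps)
  \<comment> \<open>\<open>case_nat 0 w\<close> prepends a zero weight at vertex
    \<open>i\<close>.\<close>
  then have "bary_weights b c (i - 1) (Suc (k + 1)) (k + 2) (case_nat 0 w) X"
    by (subst bary_weights_Suc_shift) auto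
  then show "X \<in> iter_line b c k i" by (auto simp: iter_line_def bary_space_def)
qed

text \<open>A common vector has two systems of \<open>k + 2\<close> weights, one ending and one
  starting with zero. By uniqueness they agree, so both ends vanish, and the \<open>k\<close> inner
  weights fall under \<open>bary_space_trivial\<close>.\<close>

lemma iter_point_Int_add_2:
  assumes "diff_regular c k (i + 1)" "sum_regular c (k + 2) (i - 1)"
  shows "iter_point b c k i \<inter> iter_point b c k (i + 2) \<subseteq> {0}"
proof
  fix X assume "X \<in> iter_point b c k i \<inter> iter_point b c k (i + 2)"
  then obtain w u where w: "bary_weights b c (i - 1) (k + 1) (k + 2) w X"
    and u: "bary_weights b c (i - 1 + 2) (k + 1) (k + 2) u X"
    by (auto simp: iter_point_def bary_space_def algebra_simps)
  have "bary_weights b c (i - 1) (k + 1) (k + 2) (w(k + 1 := 0)) X"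
    using w by (subst bary_weights_cong[where w' = w]) auto
  then have w': "bary_weights b c (i - 1) (Suc (k + 1)) (k + 2) (w(k + 1 := 0)) X"
    by (subst bary_weights_Suc) auto
  have u': "bary_weights b c (i - 1) (Suc (k + 1)) (k + 2) (case_nat 0 u) X"
    using u by (subst bary_weights_Suc_shift) auto
  have "sum_regular c (Suc (k + 1)) (i - 1)" using assms(2) by simp
  then have "(w(k + 1 := 0)) 0 = case_nat 0 u 0"
    by (rule bary_weights_unique[OF _ w' u']) auto
  then have "w 0 = 0" by simp
  then have "bary_weights b c (i - 1 + 2) k (k + 2) (\<lambda>j. w (Suc j)) X"
    using w bary_weights_Suc_shift[of w b c "i - 1" k] by simp
  then have "X \<in> bary_space b c (i + 1) k (k + 2)" by (auto simp: bary_space_def algebra_simps)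
  then show "X \<in> {0}" using bary_space_trivial[OF assms(1)] by blast
qed

text \<open>For the harder inclusion, a nonzero \<open>Y\<close> in vertex \<open>i + 2\<close> has
  nonzero last weight. Subtracting a multiple of \<open>Y\<close> from a vector of the diagonal
  removes the last weight and leaves a vector of vertex \<open>i\<close>.\<close>

lemma iter_line_eq_join:
  assumes "diff_regular c k (i + 1)" "proj_point (iter_point b c k (i + 2))"
  shows "proj_join (iter_point b c k i) (iter_point b c k (i + 2)) = iter_line b c k i"
proof
  show "proj_join (iter_point b c k i) (iter_point b c k (i + 2)) \<subseteq> iter_line b c k i"
    unfolding proj_join_def
    by (intro span_minimal Un_least iter_point_subset_iter_line iter_point_add_2_subset_iter_line)
      (simp add: iter_line_def subspace_bary_space)
  have "\<not> iter_point b c k (i + 2) \<subseteq> {0}"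
    using assms(2) unfolding proj_point_def dim_eq_0[symmetric] by linarith
  then obtain Y where Y: "Y \<in> iter_point b c k (i + 2)" "Y \<noteq> 0" by blast
  obtain u where u: "bary_weights b c (i - 1 + 2) (k + 1) (k + 2) u Y"
    using Y by (auto simp: iter_point_def bary_space_def algebra_simps)
  then have "bary_weights b c (i + 1) (Suc k) (k + 2) u Y" by (simp add: algebra_simps)
  then have uk: "u k \<noteq> 0" using bary_weights_last_nonzero assms(1) Y(2) by blast
  have u': "bary_weights b c (i - 1) (Suc (k + 1)) (k + 2) (case_nat 0 u) Y"
    using u by (subst bary_weights_Suc_shift) auto
  show "iter_line b c k i \<subseteq> proj_join (iter_point b c k i) (iter_point b c k (i + 2))"
  proof
    fix X assume "X \<in> iter_line b c k i"
    then obtain w where w: "bary_weights b c (i - 1) (Suc (k + 1)) (k + 2) w X"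
      by (auto simp: iter_line_def bary_space_def)
    define a where "a = w (k + 1) / u k"
    have "bary_weights b c (i - 1) (Suc (k + 1)) (k + 2)
        (\<lambda>j. w j + (- a) * case_nat 0 u j) (X + (- a) *\<^sub>R Y)"
      by (rule bary_weights_linear[OF w u'])
    moreover have "w (k + 1) + (- a) * case_nat 0 u (k + 1) = 0" using uk by (simp add: a_def)
    ultimately have "bary_weights b c (i - 1) (k + 1) (k + 2)
        (\<lambda>j. w j + (- a) * case_nat 0 u j) (X + (- a) *\<^sub>R Y)"
      by (subst bary_weights_Suc[symmetric])
    then have "X + (- a) *\<^sub>R Y \<in> iter_point b c k i"
      unfolding iter_point_def bary_space_def by blast
    then have "X + (- a) *\<^sub>R Y \<in> proj_join (iter_point b c k i) (iter_point b c k (i + 2))"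
      unfolding proj_join_def by (intro span_base UnI1)
    moreover have "a *\<^sub>R Y \<in> proj_join (iter_point b c k i) (iter_point b c k (i + 2))"
      unfolding proj_join_def using Y(1) by (intro span_scale span_base UnI2)
    ultimately have "(X + (- a) *\<^sub>R Y) + a *\<^sub>R Y \<in> proj_join (iter_point b c k i) (iter_point b c k (i + 2))"
      unfolding proj_join_def by (rule span_add)
    then show "X \<in> proj_join (iter_point b c k i) (iter_point b c k (i + 2))" by simp
  qed
qed

text \<open>The windows of the two diagonals share \<open>k + 1\<close> sides, which is enough for
  their weights of a common vector to agree. One weight system then satisfies the conditions on the
  union, a window of \<open>k + 3\<close> sides.\<close>

lemma iter_line_Int:
  assumes "sum_regular c (k + 2) i"
  shows "iter_line b c k i \<inter> iter_line b c k (i + 1) = iter_point b c (Suc k) i"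
proof
  show "iter_point b c (Suc k) i \<subseteq> iter_line b c k i \<inter> iter_line b c k (i + 1)"
  proof
    fix X assume "X \<in> iter_point b c (Suc k) i"
    then obtain w where "bary_weights b c (i - 1) (k + 2) (k + 3) w X"
      by (auto simp: iter_point_def bary_space_def numeral_3_eq_3)
    then have "bary_weights b c (i - 1) (k + 2) (k + 2) w X" "bary_weights b c i (k + 2) (k + 2) w X"
      by (auto simp: bary_weights_def)
    then show "X \<in> iter_line b c k i \<inter> iter_line b c k (i + 1)"
      by (auto simp: iter_line_def bary_space_def)
  qed
  show "iter_line b c k i \<inter> iter_line b c k (i + 1) \<subseteq> iter_point b c (Suc k) i"
  proof
    fix X assume "X \<in> iter_line b c k i \<inter> iter_line b c k (i + 1)"
    then obtain w u where w: "bary_weights b c (i - 1) (k + 2) (k + 2) w X"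
      and u: "bary_weights b c i (k + 2) (k + 2) u X"
      unfolding iter_line_def bary_space_def by auto
    have "w j = u j" if "j < k + 2" for j
      by (rule bary_weights_unique[OF assms w u _ that]) auto
    from bary_weights_cong[OF this] have u': "bary_weights b c i (k + 2) (k + 2) w X"
      using u by simp
    have "side_sum c (k + 2) w l = side_coord b l X" if "l \<in> {i - 1..<i - 1 + int (k + 3)}" for l
    proof (cases "l < i - 1 + int (k + 2)")
      case True
      then have "l \<in> {i - 1..<i - 1 + int (k + 2)}" using that by simp
      with w show ?thesis unfolding bary_weights_def by blast
    next
      case False
      then have "l \<in> {i..<i + int (k + 2)}" using that by simp
      with u' show ?thesis unfolding bary_weights_def by blast
    qed
    with w have "bary_weights b c (i - 1) (k + 2) (k + 3) w X" unfolding bary_weights_def by blast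
    then show "X \<in> iter_point b c (Suc k) i"
      by (auto simp: iter_point_def bary_space_def numeral_3_eq_3)
  qed
qed

text \<open>Subtracting a multiple of a fixed nonzero \<open>Y\<close> removes the last weight, and
  then nothing but zero is left.\<close>

lemma dim_iter_point_le:
  assumes "diff_regular c k (i - 1)"
  shows "dim (iter_point b c k i) \<le> 1"
proof (cases "iter_point b c k i \<subseteq> {0}")
  case True
  then have "dim (iter_point b c k i) = 0" by (simp only: dim_eq_0)
  then show ?thesis by linarith
next
  case False
  then obtain Y u where Y: "Y \<noteq> 0" and u: "bary_weights b c (i - 1) (Suc k) (k + 2) u Y"
    by (auto simp: iter_point_def bary_space_def)
  have uk: "u k \<noteq> 0" by (rule bary_weights_last_nonzero[OF assms u Y])
  have "iter_point b c k i \<subseteq> span {Y}"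
  proof
    fix X assume "X \<in> iter_point b c k i"
    then obtain w where w: "bary_weights b c (i - 1) (Suc k) (k + 2) w X"
      by (auto simp: iter_point_def bary_space_def)
    define a where "a = w k / u k"
    have "w k + (- a) * u k = 0" using uk by (simp add: a_def)
    with bary_weights_last_nonzero[OF assms bary_weights_linear[OF w u]]
    have "X + (- a) *\<^sub>R Y = 0" by blast
    then have "X = a *\<^sub>R Y" by simp
    then show "X \<in> span {Y}" by (simp add: span_base span_scale)
  qed
  from dim_subset[OF this] show ?thesis using Y by (simp add: dim_span)
qed

lemma short_diagonal_iter_point:
  assumes "\<And>i. diff_regular c k i" "\<And>i. sum_regular c (k + 2) i"
    and "\<And>i. proj_point (iter_point b c k i)"
  shows "iter_point b c k i \<noteq> iter_point b c k (i + 2)"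
    and "short_diagonal (iter_point b c k) i = iter_line b c k i"
    and "proj_line (iter_line b c k i)"
proof -
  show ne: "iter_point b c k i \<noteq> iter_point b c k (i + 2)"
  proof
    assume "iter_point b c k i = iter_point b c k (i + 2)"
    then have "iter_point b c k i \<subseteq> {0}" using iter_point_Int_add_2[OF assms(1,2), of b i] by simp
    then have "dim (iter_point b c k i) = 0" by (simp only: dim_eq_0)
    then show False using assms(3)[of i] unfolding proj_point_def by linarith
  qed
  show eq: "short_diagonal (iter_point b c k) i = iter_line b c k i"
    unfolding short_diagonal_def by (rule iter_line_eq_join[OF assms(1,3)])
  show "proj_line (iter_line b c k i)"
    using proj_line_proj_join[OF assms(3,3) ne] eq by (simp add: short_diagonal_def)
qed

text \<open>Equal successive diagonals would make their intersection
  \<open>iter_point b c (Suc k) i\<close> two-dimensional, against \<open>diff_regular\<close> at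
  \<open>Suc k\<close>. So the map is defined, and the new vertices are points as intersections of
  distinct lines.\<close>

lemma pentagram_iter_point:
  assumes "\<And>i. diff_regular c k i" "\<And>i. diff_regular c (Suc k) i" "\<And>i. sum_regular c (k + 2) i"
    and "\<And>i. proj_point (iter_point b c k i)"
  shows "pentagram (iter_point b c k) = Some (iter_point b c (Suc k))"
    and "proj_point (iter_point b c (Suc k) i)"
proof -
  note diag = short_diagonal_iter_point[OF assms(1,3,4)]
  have ne: "iter_line b c k i \<noteq> iter_line b c k (i + 1)" for i
  proof
    assume "iter_line b c k i = iter_line b c k (i + 1)"
    then have "iter_line b c k i = iter_point b c (Suc k) i" using iter_line_Int[OF assms(3), of b i] by simp
    then show False
      using diag(3)[of i] dim_iter_point_le[OF assms(2), of b i] unfolding proj_line_def by simp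
  qed
  show "pentagram (iter_point b c k) = Some (iter_point b c (Suc k))"
    unfolding pentagram_def diag(2) iter_line_Int[OF assms(3)] using diag(1) ne by (simp only: if_True simp_thms)
  show "proj_point (iter_point b c (Suc k) i)"
    using proj_point_Int[OF diag(3) diag(3) ne, of i] unfolding iter_line_Int[OF assms(3)] .
qed

lemma pentagram_iterate_iter_point:
  assumes "\<And>k i. k \<le> K \<Longrightarrow> diff_regular c k i" "\<And>k i. k \<le> K \<Longrightarrow> sum_regular c (k + 2) i"
    and "\<And>i. proj_point (iter_point b c 0 i)" and "k \<le> K"
  shows "pentagram_iterate k (iter_point b c 0) = Some (iter_point b c k) \<and>
    (\<forall>i. proj_point (iter_point b c k i))"
  using \<open>k \<le> K\<close>
proof (induction k)
  case 0
  then show ?case using assms(3) by simp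
next
  case (Suc k)
  then have "k \<le> K" by simp
  have "proj_point (iter_point b c k i)" for i using Suc by simp
  note step = pentagram_iter_point[OF assms(1)[OF \<open>k \<le> K\<close>] assms(1)[OF Suc.prems]
      assms(2)[OF \<open>k \<le> K\<close>] this]
  then show ?case using Suc by simp
qed

text \<open>With as many weights as there are vertices in a class, the weights can be shifted cyclically.\<close>

lemma bary_space_cyclic:
  assumes "\<And>l. c (l + 2 * int r) = c l"
  shows "bary_space b c i r h \<subseteq> bary_space b c (i + 2) r h"
proof (cases r)
  case 0
  then show ?thesis
    unfolding bary_space_def bary_weights_def ball_shift_2[symmetric] by (simp add: side_sum_def)
next
  case (Suc s)
  show ?thesis
  proof
    fix X assume "X \<in> bary_space b c i r h"
    then obtain w where w: "bary_weights b c i r h w X" by (auto simp: bary_space_def)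
    define u where "u j = (if j < s then w (Suc j) else w 0)" for j
    have "side_sum c r u (l + 2) = side_sum c r w l" for l
    proof -
      \<comment> \<open>The weight moved to the end meets side \<open>l + 2 * r\<close>, which by
        periodicity has the same value as side \<open>l\<close>.\<close>
      have "c (l + 2 + 2 * int s) = c l" using assms[of l] Suc by (simp add: algebra_simps)
      then have "side_sum c r u (l + 2) = (\<Sum>j<s. w (Suc j) * c (l + 2 + 2 * int j)) + w 0 * c l"
        by (simp add: side_sum_def Suc u_def)
      then show ?thesis by (simp add: Suc side_sum_Suc_shift) (simp add: side_sum_def)
    qed
    moreover have "(\<Sum>j<r. u j) = (\<Sum>j<r. w j)"
      unfolding Suc by (subst (2) sum.lessThan_Suc_shift) (simp add: u_def)
    ultimately have "bary_weights b c (i + 2) r h u X"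
      using w unfolding bary_weights_def ball_shift_2[symmetric] by simp
    then show "X \<in> bary_space b c (i + 2) r h" by (auto simp: bary_space_def)
  qed
qed

text \<open>The cyclic shift gives an inclusion between diagonals \<open>i\<close> and
  \<open>i + 2\<close>; both have dimension 2, so they coincide.\<close>

lemma iter_line_parity:
  assumes "\<And>i. diff_regular c (2 * n - 2) i" "\<And>i. sum_regular c (2 * n) i"
    and "\<And>i. proj_point (iter_point b c (2 * n - 2) i)"
    and per: "\<And>l. c (l + int (4 * n)) = c l" and "n \<ge> 1"
  shows "iter_line b c (2 * n - 2) (i + 2 * j) = iter_line b c (2 * n - 2) i"
proof -
  have "2 * n - 2 + 2 = 2 * n" using assms(5) by simp
  then have "sum_regular c (2 * n - 2 + 2) i" for i using assms(2) by metis
  note line = short_diagonal_iter_point(3)[OF assms(1) this assms(3)]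
  have per': "c (l + 2 * int (2 * n)) = c l" for l using per[of l] by simp
  have two: "iter_line b c (2 * n - 2) (i + 2) = iter_line b c (2 * n - 2) i" for i
  proof -
    have "iter_line b c (2 * n - 2) i \<subseteq> iter_line b c (2 * n - 2) (i + 2)"
      using bary_space_cyclic[where c = c and r = "2 * n" and i = "i - 1", OF per']
      unfolding iter_line_def \<open>2 * n - 2 + 2 = 2 * n\<close> by (simp add: algebra_simps)
    then show ?thesis
      using subspace_dim_equal line by (metis order_refl proj_line_def)
  qed
  show ?thesis
  proof (induction j rule: int_induct[where k = 0])
    case (step1 j)
    then show ?case using two[of "i + 2 * j"] by (simp add: algebra_simps)
  next
    case (step2 j)
    then show ?case using two[of "i + 2 * (j - 1)"] by (simp add: algebra_simps)
  qed simp
qed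

section \<open>Genericity of the regularity conditions\<close>

definition cyclic_ext :: "nat \<Rightarrow> (nat \<Rightarrow> real) \<Rightarrow> int \<Rightarrow> real" where
  "cyclic_ext N v l = v (nat (l mod int N))"

text \<open>The test configuration of the introduction: for \<alpha> and \<beta> of opposite parity,
  one unit entry per parity class modulo \<open>4 * n\<close>.\<close>

definition spikes :: "nat \<Rightarrow> int \<Rightarrow> int \<Rightarrow> int \<Rightarrow> real" where
  "spikes n \<alpha> \<beta> l = of_bool (int (4 * n) dvd l - \<alpha> \<or> int (4 * n) dvd l - \<beta>)"

lemma dvd_double_imp_eq:
  assumes "int (4 * n) dvd 2 * x" "\<bar>x\<bar> < int (2 * n)"
  shows "x = 0"
proof -
  have "2 * int (2 * n) dvd 2 * x" using assms(1) by simp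
  then have "int (2 * n) dvd x" by (subst (asm) dvd_mult_cancel_left) simp
  then show ?thesis using assms(2) dvd_imp_le_int[of x "int (2 * n)"] by fastforce
qed

text \<open>The spike of the other parity is never met. The one at \<open>l + 2 * d\<close> is met
  only by weight \<open>d\<close>, since the bounds on \<open>d\<close> keep
  \<open>\<bar>j - d\<bar>\<close> below \<open>2 * n\<close> and so exclude its periodic
  copies.\<close>

lemma side_sum_spikes:
  assumes "\<alpha> = l + 2 * d \<and> odd (l - \<beta>) \<or> \<beta> = l + 2 * d \<and> odd (l - \<alpha>)"
    and "d < int (2 * n)" "int r - d \<le> int (2 * n)"
  shows "side_sum (spikes n \<alpha> \<beta>) r w l = (if 0 \<le> d \<and> d < int r then w (nat d) else 0)"
proof -
  have iff: "(int (4 * n) dvd l + 2 * int j - \<alpha> \<or> int (4 * n) dvd l + 2 * int j - \<beta>) \<longleftrightarrow> int j = d"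
    if "j < r" for j
  proof -
    have odd: "\<not> int (4 * n) dvd l + 2 * int j - x" if "odd (l - x)" for x
    proof
      assume "int (4 * n) dvd l + 2 * int j - x"
      moreover have "even (int (4 * n))" by simp
      ultimately have "even (l + 2 * int j - x)" by (rule dvd_trans[rotated])
      then show False using that by auto
    qed
    have "int (4 * n) dvd l + 2 * int j - (l + 2 * d) \<longleftrightarrow> int j = d"
    proof
      assume "int (4 * n) dvd l + 2 * int j - (l + 2 * d)"
      then have "int (4 * n) dvd 2 * (int j - d)" by (simp add: algebra_simps)
      then have "int j - d = 0" using assms(2,3) that by (intro dvd_double_imp_eq) auto
      then show "int j = d" by simp
    qed simp
    then show ?thesis using odd assms(1) by auto
  qed
  have "side_sum (spikes n \<alpha> \<beta>) r w l = (\<Sum>j<r. if int j = d then w j else 0)"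
    unfolding side_sum_def spikes_def
  proof (intro sum.cong refl)
    fix j assume "j \<in> {..<r}"
    then have j: "j < r" by simp
    show "w j * of_bool (int (4 * n) dvd l + 2 * int j - \<alpha> \<or> int (4 * n) dvd l + 2 * int j - \<beta>) =
        (if int j = d then w j else 0)"
      unfolding iff[OF j] by simp
  qed
  also have "\<dots> = (\<Sum>j<r. if j = nat d \<and> 0 \<le> d then w j else 0)"
    by (intro sum.cong) auto
  also have "\<dots> = (if 0 \<le> d \<and> d < int r then w (nat d) else 0)"
    by (cases "0 \<le> d") (auto simp: sum.delta nat_less_iff)
  finally show ?thesis .
qed

text \<open>The even and the odd spike each lie outside the window of \<open>k\<close> columns for one row, so both
  common values of the side sums vanish; the other rows isolate the single weights.\<close>

lemma diff_regular_spikes: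
  assumes "k + 2 \<le> 2 * n"
  shows "diff_regular (spikes n (i + 2 * (int ((k + 1) div 2) - 1)) (i + 1 + 2 * int k)) k i"
  unfolding diff_regular_def
proof (intro allI impI)
  \<comment> \<open>Row \<open>u\<close> at even distance \<open>2 * u\<close> from \<open>i\<close>
    isolates weight \<open>t - 1 - u\<close> for \<open>u < t\<close> and is zero for
    \<open>u = t\<close>. Row \<open>u\<close> at odd distance \<open>2 * u + 1\<close> isolates
    weight \<open>k - u\<close> for \<open>u > 0\<close> and is zero for \<open>u = 0\<close>. With
    this \<open>t\<close> the rows of the window reach every weight.\<close>
  define t where "t = (k + 1) div 2"
  define \<alpha> where "\<alpha> = i + 2 * (int t - 1)"
  define \<beta> where "\<beta> = i + 1 + 2 * int k"
  have t: "2 * t \<le> k + 1" "k \<le> 2 * t" unfolding t_def by linarith+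
  fix w j
  let ?f = "side_sum (spikes n \<alpha> \<beta>) k w"
  assume "\<forall>l\<in>{i..<i + int k}.
      side_sum (spikes n (i + 2 * (int ((k + 1) div 2) - 1)) (i + 1 + 2 * int k)) k w (l + 2) =
      side_sum (spikes n (i + 2 * (int ((k + 1) div 2) - 1)) (i + 1 + 2 * int k)) k w l"
    and j: "j < k"
  then have f: "?f (l + 2) = ?f l" if "l \<in> {i..<i + int k}" for l
    using that by (simp add: \<alpha>_def \<beta>_def t_def)
  have even: "2 * u \<le> k + 1 \<Longrightarrow> ?f (i + 2 * int u) = ?f i" for u
  proof (induction u)
    case (Suc u)
    then show ?case using f[of "i + 2 * int u"] by (simp add: algebra_simps)
  qed simp
  have odd: "2 * u \<le> k \<Longrightarrow> ?f (i + 1 + 2 * int u) = ?f (i + 1)" for u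
  proof (induction u)
    case (Suc u)
    then show ?case using f[of "i + 1 + 2 * int u"] by (simp add: algebra_simps)
  qed simp
  have even_row: "?f (i + 2 * int u) = (if u < t then w (t - 1 - u) else 0)" if "u \<le> t" for u
    using that t assms
    by (subst side_sum_spikes[where d = "int t - 1 - int u"])
      (auto simp: \<alpha>_def \<beta>_def nat_diff_distrib' intro!: arg_cong[of _ _ w])
  have odd_row: "?f (i + 1 + 2 * int u) = (if 0 < u then w (k - u) else 0)" if "u \<le> k" for u
    using that t assms
    by (subst side_sum_spikes[where d = "int k - int u"])
      (auto simp: \<alpha>_def \<beta>_def nat_diff_distrib' intro!: arg_cong[of _ _ w])
  have "?f i = 0" using even[of t] even_row[of t] t by simp
  moreover have "?f (i + 1) = 0" using odd_row[of 0] by simp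
  ultimately show "w j = 0"
  proof (cases "j < t")
    case True
    then have "?f (i + 2 * int (t - 1 - j)) = w j" by (subst even_row) auto
    then show ?thesis using even[of "t - 1 - j"] \<open>?f i = 0\<close> t True by simp
  next
    case False
    then have "?f (i + 1 + 2 * int (k - j)) = w j" using j by (subst odd_row) auto
    then show ?thesis using odd[of "k - j"] \<open>?f (i + 1) = 0\<close> t False by simp
  qed
qed

text \<open>With \<open>t = r div 2\<close>, the rows at even distance from \<open>i\<close> isolate
  the weights below \<open>t\<close>, those at odd distance the weights from \<open>t\<close> to
  \<open>r - 2\<close>. The vanishing sum then disposes of the last weight.\<close>

lemma sum_regular_spikes:
  assumes "r \<le> 2 * n" "r \<ge> 1"
  shows "sum_regular (spikes n (i + 2 * (int (r div 2) - 1)) (i + 1 + 2 * (int r - 2))) r i"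
  unfolding sum_regular_def
proof (intro allI impI, elim conjE)
  define t where "t = r div 2"
  define \<alpha> where "\<alpha> = i + 2 * (int t - 1)"
  define \<beta> where "\<beta> = i + 1 + 2 * (int r - 2)"
  have t: "2 * t \<le> r" "r \<le> 2 * t + 1" unfolding t_def by linarith+
  fix w j
  let ?f = "side_sum (spikes n \<alpha> \<beta>) r w"
  assume sum: "(\<Sum>j<r. w j) = 0" and "\<forall>l\<in>{i..<i + int r - 1}.
      side_sum (spikes n (i + 2 * (int (r div 2) - 1)) (i + 1 + 2 * (int r - 2))) r w l = 0"
    and j: "j < r"
  then have f: "?f l = 0" if "l \<in> {i..<i + int r - 1}" for l
    using that by (simp add: \<alpha>_def \<beta>_def t_def)
  have zero: "w j = 0" if "j < r - 1" for j
  proof (cases "j < t")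
    case True
    have "?f (i + 2 * (int t - 1 - int j)) = w j"
      using True t assms by (subst side_sum_spikes[where d = "int j"]) (auto simp: \<alpha>_def \<beta>_def)
    then show ?thesis using f[of "i + 2 * (int t - 1 - int j)"] True t by simp
  next
    case False
    have "?f (i + 1 + 2 * (int r - 2 - int j)) = w j"
      using that t assms by (subst side_sum_spikes[where d = "int j"]) (auto simp: \<alpha>_def \<beta>_def)
    then show ?thesis using f[of "i + 1 + 2 * (int r - 2 - int j)"] that False t by simp
  qed
  have "(\<Sum>j<r. w j) = (\<Sum>j<Suc (r - 1). w j)" using assms by simp
  then have "w (r - 1) = 0" using sum zero by simp
  then show "w j = 0" using zero j by (cases "j = r - 1") auto
qed

section \<open>From the spikes to generic parameters\<close>

lemma cyclic_ext_spikes: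
  assumes "n \<ge> 1"
  shows "cyclic_ext (4 * n) (\<lambda>x\<in>{..<4 * n}. spikes n \<alpha> \<beta> (int x)) = spikes n \<alpha> \<beta>"
proof
  fix l
  have "nat (l mod int (4 * n)) < 4 * n" "0 \<le> l mod int (4 * n)"
    using assms by (auto simp: nat_less_iff)
  moreover have "int (4 * n) dvd l mod int (4 * n) - x \<longleftrightarrow> int (4 * n) dvd l - x" for x
    by (metis mod_diff_left_eq mod_eq_0_iff_dvd)
  ultimately show "cyclic_ext (4 * n) (\<lambda>x\<in>{..<4 * n}. spikes n \<alpha> \<beta> (int x)) l = spikes n \<alpha> \<beta> l"
    by (simp add: cyclic_ext_def spikes_def)
qed

lemma polynomial_fun_cyclic_ext:
  assumes "N \<ge> 1"
  shows "polynomial_fun {..<N} (\<lambda>v. cyclic_ext N v l)"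
  unfolding cyclic_ext_def
  by (rule polynomial_fun.coord) (use assms in \<open>auto simp: nat_less_iff\<close>)

lemma ball_int_interval: "(\<forall>l\<in>{i..<i + int k}. Q l) \<longleftrightarrow> (\<forall>m<k. Q (i + int m))"
proof
  assume *: "\<forall>m<k. Q (i + int m)"
  show "\<forall>l\<in>{i..<i + int k}. Q l"
  proof
    fix l assume "l \<in> {i..<i + int k}"
    then show "Q l" using *[rule_format, of "nat (l - i)"] by auto
  qed
qed simp

lemma diff_regular_iff:
  "diff_regular c k i \<longleftrightarrow>
    (\<forall>w. (\<forall>m<k. (\<Sum>j<k. w j * (c (i + int m + 2 + 2 * int j) - c (i + int m + 2 * int j))) = 0) \<longrightarrow>
      (\<forall>j<k. w j = 0))"
  unfolding diff_regular_def ball_int_interval side_sum_def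
  by (simp add: algebra_simps sum_subtractf)

text \<open>Puts the condition in the square form of \<open>zariski_generic_trivial_kernel\<close>:
  row 0 is the sum of the weights, and row \<open>m > 0\<close> belongs to side
  \<open>i + m - 1\<close>.\<close>

lemma sum_regular_iff:
  "sum_regular c (Suc r) i \<longleftrightarrow>
    (\<forall>w. (\<forall>m<Suc r. (\<Sum>j<Suc r. w j * (if m = 0 then 1 else c (i + int (m - 1) + 2 * int j))) = 0) \<longrightarrow>
      (\<forall>j<Suc r. w j = 0))"
proof -
  have "{i..<i + int (Suc r) - 1} = {i..<i + int r}" by auto
  then show ?thesis
    unfolding sum_regular_def side_sum_def
    by (simp add: ball_int_interval All_less_Suc2 del: sum.lessThan_Suc)
qed

lemma zariski_generic_diff_regular:
  assumes "k + 2 \<le> 2 * n"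
  shows "zariski_generic {..<4 * n} (\<lambda>v. diff_regular (cyclic_ext (4 * n) v) k i)"
  unfolding diff_regular_iff
proof (rule zariski_generic_trivial_kernel)
  let ?\<alpha> = "i + 2 * (int ((k + 1) div 2) - 1)" and ?\<beta> = "i + 1 + 2 * int k"
  have n: "4 * n \<ge> 1" "n \<ge> 1" using assms by linarith+
  show "polynomial_fun {..<4 * n} (\<lambda>v. cyclic_ext (4 * n) v (i + int m + 2 + 2 * int j) -
      cyclic_ext (4 * n) v (i + int m + 2 * int j))" for m j
    by (intro polynomial_fun_diff polynomial_fun_cyclic_ext n)
  show "(\<lambda>x\<in>{..<4 * n}. spikes n ?\<alpha> ?\<beta> (int x)) \<in> affine_space {..<4 * n}"
    by (simp add: affine_space_def)
  show "\<forall>j<k. w j = 0" if "\<And>m. m < k \<Longrightarrow> (\<Sum>j<k. w j *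
      (cyclic_ext (4 * n) (\<lambda>x\<in>{..<4 * n}. spikes n ?\<alpha> ?\<beta> (int x)) (i + int m + 2 + 2 * int j) -
       cyclic_ext (4 * n) (\<lambda>x\<in>{..<4 * n}. spikes n ?\<alpha> ?\<beta> (int x)) (i + int m + 2 * int j))) = 0" for w
    using diff_regular_spikes[OF assms, of i] that
    unfolding cyclic_ext_spikes[OF n(2)] diff_regular_iff by blast
qed

lemma zariski_generic_sum_regular:
  assumes "Suc r \<le> 2 * n"
  shows "zariski_generic {..<4 * n} (\<lambda>v. sum_regular (cyclic_ext (4 * n) v) (Suc r) i)"
  unfolding sum_regular_iff
proof (rule zariski_generic_trivial_kernel)
  let ?\<alpha> = "i + 2 * (int (Suc r div 2) - 1)" and ?\<beta> = "i + 1 + 2 * (int (Suc r) - 2)"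
  have n: "4 * n \<ge> 1" "n \<ge> 1" using assms by linarith+
  show "polynomial_fun {..<4 * n}
      (\<lambda>v. if m = 0 then 1 else cyclic_ext (4 * n) v (i + int (m - 1) + 2 * int j))" for m j
    using polynomial_fun_cyclic_ext[OF n(1)] polynomial_fun.const by (cases "m = 0") auto
  show "(\<lambda>x\<in>{..<4 * n}. spikes n ?\<alpha> ?\<beta> (int x)) \<in> affine_space {..<4 * n}"
    by (simp add: affine_space_def)
  show "\<forall>j<Suc r. w j = 0" if "\<And>m. m < Suc r \<Longrightarrow> (\<Sum>j<Suc r. w j * (if m = 0 then 1 else
      cyclic_ext (4 * n) (\<lambda>x\<in>{..<4 * n}. spikes n ?\<alpha> ?\<beta> (int x)) (i + int (m - 1) + 2 * int j))) = 0" for w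
    using sum_regular_spikes[OF assms, of i] that
    unfolding cyclic_ext_spikes[OF n(2)] sum_regular_iff by simp
qed

text \<open>Reduces the conditions for all integers \<open>i\<close> to finitely many residues, so
  that a finite conjunction covers them.\<close>

lemma regular_mod:
  fixes N :: nat
  assumes "\<And>l. c (l mod int N) = c l"
  shows "diff_regular c k (i mod int N) = diff_regular c k i"
    and "sum_regular c (Suc r) (i mod int N) = sum_regular c (Suc r) i"
proof -
  have "c (i mod int N + x) = c (i + x)" for x
    by (metis assms mod_add_left_eq)
  then show "diff_regular c k (i mod int N) = diff_regular c k i"
    and "sum_regular c (Suc r) (i mod int N) = sum_regular c (Suc r) i"
    unfolding diff_regular_iff sum_regular_iff add.assoc by auto
qed

lemma zariski_generic_regular:
  assumes "n \<ge> 1"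
  shows "zariski_generic {..<4 * n} (\<lambda>v. \<forall>k\<le>2 * n - 2. \<forall>i.
    diff_regular (cyclic_ext (4 * n) v) k i \<and> sum_regular (cyclic_ext (4 * n) v) (k + 2) i)"
proof -
  have "zariski_generic {..<4 * n} (\<lambda>v. \<forall>(k, i)\<in>{..2 * n - 2} \<times> {0..<int (4 * n)}.
    diff_regular (cyclic_ext (4 * n) v) k i \<and> sum_regular (cyclic_ext (4 * n) v) (Suc (k + 1)) i)"
    unfolding case_prod_unfold
    using assms
    by (intro zariski_generic_ball zariski_generic_conj zariski_generic_diff_regular
        zariski_generic_sum_regular) (auto simp: le_diff_conv2)
  moreover have "diff_regular (cyclic_ext (4 * n) v) k i \<and> sum_regular (cyclic_ext (4 * n) v) (k + 2) i"
    if "\<forall>(k, i)\<in>{..2 * n - 2} \<times> {0..<int (4 * n)}.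
      diff_regular (cyclic_ext (4 * n) v) k i \<and> sum_regular (cyclic_ext (4 * n) v) (Suc (k + 1)) i"
      and "k \<le> 2 * n - 2" for v k i
  proof -
    have "i mod int (4 * n) \<in> {0..<int (4 * n)}" using assms by auto
    then have "diff_regular (cyclic_ext (4 * n) v) k (i mod int (4 * n)) \<and>
        sum_regular (cyclic_ext (4 * n) v) (Suc (k + 1)) (i mod int (4 * n))"
      using that by blast
    moreover have "cyclic_ext (4 * n) v (l mod int (4 * n)) = cyclic_ext (4 * n) v l" for l
      by (simp only: cyclic_ext_def mod_mod_trivial)
    ultimately show ?thesis using regular_mod by (metis add_2_eq_Suc' Suc_eq_plus1)
  qed
  ultimately show ?thesis unfolding zariski_generic_def by blast
qed

section \<open>Axis-parallel polygons\<close>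

lemma cyclic_ext_side_params:
  assumes "n \<ge> 1" "cyclic_seq (4 * n) p"
  shows "cyclic_ext (4 * n) (side_params n b p) l = (if even l = b then fst (p l) else snd (p l))"
proof -
  have lt: "nat (l mod int (4 * n)) < 4 * n" and ge: "0 \<le> l mod int (4 * n)"
    using assms by (auto simp: nat_less_iff)
  have "even (int (4 * n))" by simp
  then have "even (l mod int (4 * n)) = even l" by (metis dvd_mod_iff)
  then have "even (nat (l mod int (4 * n))) = even l" using ge by (metis even_of_nat int_nat_eq)
  then show ?thesis
    using lt ge cyclic_seq_mod[OF assms(2), of l] by (simp add: cyclic_ext_def side_params_def)
qed

text \<open>Start of the induction: the only weight is the third homogeneous coordinate, and the two
  sides of the window fix one affine coordinate each.\<close>

lemma iter_point_0:
  assumes "sides_alternately_parallel b p"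
    and c: "\<And>l. c l = (if even l = b then fst (p l) else snd (p l))"
  shows "iter_point b c 0 i = proj_of_affine (p i)"
proof -
  \<comment> \<open>Side \<open>i - 1\<close> ends at vertex \<open>i\<close>, so the coordinate
    that it fixes can be read off there.\<close>
  have pred: "if even (i - 1) = b then fst (p (i - 1)) = fst (p i) else snd (p (i - 1)) = snd (p i)"
    using assms(1)[unfolded sides_alternately_parallel_def, rule_format, of "i - 1"] by simp
  have "{i - 1..<i - 1 + int (0 + 2)} = {i - 1, i}" by auto
  then have "iter_point b c 0 i = {X. vec_nth X 3 * c (i - 1) = side_coord b (i - 1) X \<and>
      vec_nth X 3 * c i = side_coord b i X}"
    by (auto simp: iter_point_def bary_space_def bary_weights_def side_sum_def)
  also have "\<dots> = {X. vec_nth X 3 * fst (p i) = vec_nth X 1 \<and> vec_nth X 3 * snd (p i) = vec_nth X 2}"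
    using pred by (auto simp: c side_coord_def split: if_splits)
  also have "\<dots> = range (\<lambda>a. a *\<^sub>R vector [fst (p i), snd (p i), 1])"
    by (auto simp: image_iff Finite_Cartesian_Product.vec_eq_iff forall_3)
  also have "\<dots> = proj_of_affine (p i)"
    by (simp add: proj_of_affine_def span_singleton)
  finally show ?thesis .
qed

theorem theorem1p3:
  fixes n :: nat and b :: bool
  assumes "n \<ge> 1"
  shows "\<exists>U. zariski_open {..<4 * n} U \<and> U \<noteq> {} \<and>
    (\<forall>p :: int \<Rightarrow> real \<times> real.
      cyclic_seq (4 * n) p \<and> sides_alternately_parallel b p \<and> side_params n b p \<in> U \<longrightarrow>
      (\<exists>Q. pentagram_iterate (2 * n - 2) (\<lambda>i. proj_of_affine (p i)) = Some Q \<and>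
        proj_collinear (Q ` {i. odd i}) \<and> proj_collinear (Q ` {i. even i})))"
proof -
  obtain U where U: "zariski_open {..<4 * n} U" "U \<noteq> {}"
    and reg: "\<And>v k i. v \<in> U \<Longrightarrow> k \<le> 2 * n - 2 \<Longrightarrow>
      diff_regular (cyclic_ext (4 * n) v) k i \<and> sum_regular (cyclic_ext (4 * n) v) (k + 2) i"
    using zariski_generic_open[OF zariski_generic_regular[OF assms]] by metis
  have "\<exists>Q. pentagram_iterate (2 * n - 2) (\<lambda>i. proj_of_affine (p i)) = Some Q \<and>
        proj_collinear (Q ` {i. odd i}) \<and> proj_collinear (Q ` {i. even i})"
    if p: "cyclic_seq (4 * n) p" "sides_alternately_parallel b p" "side_params n b p \<in> U" for p
  proof -
    define c where "c = cyclic_ext (4 * n) (side_params n b p)"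
    define K where "K = 2 * n - 2"
    have K2: "K + 2 = 2 * n" using assms by (simp add: K_def)
    have c: "c l = (if even l = b then fst (p l) else snd (p l))" for l
      unfolding c_def by (rule cyclic_ext_side_params[OF assms p(1)])
    have per: "c (l + int (4 * n)) = c l" for l
      by (simp only: c_def cyclic_ext_def mod_add_self2)
    have reg: "diff_regular c k i" "sum_regular c (k + 2) i" if "k \<le> K" for k i
      using reg[OF p(3), of k i] that by (auto simp: c_def K_def)
    have P0: "iter_point b c 0 = (\<lambda>i. proj_of_affine (p i))"
      using iter_point_0[OF p(2) c] by (rule ext)
    then have "proj_point (iter_point b c 0 i)" for i by (simp add: proj_point_proj_of_affine)
    from pentagram_iterate_iter_point[OF reg this order_refl]
    have iter: "pentagram_iterate K (iter_point b c 0) = Some (iter_point b c K)"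
      and point: "\<And>i. proj_point (iter_point b c K i)" by auto
    have line: "proj_line (iter_line b c K i)" for i
      by (rule short_diagonal_iter_point(3)[OF reg[OF order_refl] point])
    have parity: "iter_line b c K (i + 2 * j) = iter_line b c K i" for i j
      unfolding K_def using reg[OF order_refl] point per assms
      by (intro iter_line_parity) (simp_all only: K_def[symmetric] K2)
    \<comment> \<open>Vertex \<open>i\<close> lies on diagonal \<open>i\<close>, which coincides
      with diagonal 0 or 1 according to parity; these two are the required lines.\<close>
    have "iter_point b c K i \<subseteq> iter_line b c K (i mod 2)" for i
      using iter_point_subset_iter_line[of b c K i] parity[of "i mod 2" "i div 2"] by simp
    then have "proj_collinear (iter_point b c K ` {i. odd i})"
      "proj_collinear (iter_point b c K ` {i. even i})"
      unfolding proj_collinear_def using line by (fastforce simp: odd_iff_mod_2_eq_one)+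
    then show ?thesis using iter by (auto simp: P0 K_def)
  qed
  then show ?thesis using U by (intro exI[of _ U]) blast
qed

end
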